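(* Let $m>3$. Promotion $\partial$ acting on $\mathrm{SYT}_R(1,m-2,1)$ has order $(m-1)(m-2)$, with exactly one orbit of size $m-2$ and $m-3$ orbits of size $m-1$. Consequently, with $\psi_m(q,t)=[m-2]_t+(m-3)[m-1]_q$, $\xi$ a primitive $(m-1)$-th root of unity and $\zeta$ a primitive $(m-2)$-th root of unity, for all integers $r,s$, \[ \psi_m(\xi^r,\zeta^s)=\#\{T\in\mathrm{SYT}_R(1,m-2,1):\partial^{r(m-2)+s(m-1)}(T)=T\}; \] i.e. $(\mathrm{SYT}_R(1,m-2,1),\langle\partial^{m-1}\rangle\times\langle\partial^{m-2}\rangle,\psi_m(q,t))$ exhibits the bicyclic sieving phenomenon.
   Context: $\mathrm{SYT}_R(1,m-2,1)$ is the set of standard Young tableaux with entries $1,\dots,m$ of the three-row ribbon shape consisting of a single box in the top row, $m-2$ boxes in the middle row and a single box in the bottom row, where the top box lies directly above the last box of the middle row and the bottom box lies directly below the first box of the middle row. Promotion $\partial$: replace $1$ by a dot; repeatedly swap the dot with the smaller of its right and lower neighbours in the shape until neither exists; decrement all entries by one and put $m$ in the dot's box. $[r]_q=1+q+\dots+q^{r-1}$. Bicyclic sieving for cyclic groups $\langle c_1\rangle,\langle c_2\rangle$ of orders $k_1,k_2$ acting on $X$ with polynomial $f(q,t)$ means $f(\zeta_1^i,\zeta_2^j)=\#\{x:c_1^ic_2^jx=x\}$ for all integers $i,j$, with $\zeta_1,\zeta_2$ primitive $k_1$-th and $k_2$-th roots of unity.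
   Formalization: In the final bicyclic sieving triple the two factors are taken in the order ⟨∂^{m−2}⟩×⟨∂^{m−1}⟩, so that q goes with ∂^{m−2} (order m−1) and t with ∂^{m−1} (order m−2), as the displayed formula requires; the printed order, read literally, fails (e.g. m=4). *)

theory Defs
  imports
    Complex_Main
    "HOL-Library.While_Combinator"
    "HOL-Algebra.Elementary_Groups"
    "HOL-Algebra.Multiplicative_Group"
    "HOL-Algebra.Group_Action"
    "HOL-Computational_Algebra.Polynomial"
begin

text \<open>Cells are pairs (row, column), indexed from 0, with rows numbered from top to bottom
  (English convention).\<close>

type_synonym cell = "nat \<times> nat"
type_synonym tableau = "cell \<Rightarrow> nat"

text \<open>Tableaux of shape \<open>D\<close> are extensional functions, so that equality of functions is equality
  of tableaux and the number of tableaux is the cardinality of the set below.\<close>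

definition SYT :: "cell set \<Rightarrow> tableau set" where
  "SYT D = {T \<in> extensional D.
     bij_betw T D {1..card D} \<and>
     (\<forall>i j j'. (i, j) \<in> D \<longrightarrow> (i, j') \<in> D \<longrightarrow> j < j' \<longrightarrow> T (i, j) < T (i, j')) \<and>
     (\<forall>i i' j. (i, j) \<in> D \<longrightarrow> (i', j) \<in> D \<longrightarrow> i < i' \<longrightarrow> T (i, j) < T (i', j))}"

definition right_lower_neighbours :: "cell set \<Rightarrow> cell \<Rightarrow> cell set" where
  "right_lower_neighbours D d = {(fst d, Suc (snd d)), (Suc (fst d), snd d)} \<inter> D"

text \<open>A state \<open>(T, d)\<close> is a filling with the dot in cell \<open>d\<close>; the value \<open>T d\<close> is irrelevant.\<close>

definition slide_step :: "cell set \<Rightarrow> tableau \<times> cell \<Rightarrow> tableau \<times> cell" where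
  "slide_step D = (\<lambda>(T, d).
     let n = arg_min_on T (right_lower_neighbours D d) in (T(d := T n), n))"

definition slide :: "cell set \<Rightarrow> tableau \<times> cell \<Rightarrow> tableau \<times> cell" where
  "slide D = while (\<lambda>(T, d). right_lower_neighbours D d \<noteq> {}) (slide_step D)"

definition promotion :: "cell set \<Rightarrow> tableau \<Rightarrow> tableau" where
  "promotion D T =
     (let (T', d) = slide D (T, the_inv_into D T 1)
      in (\<lambda>c\<in>D. if c = d then card D else T' c - 1))"

definition ribbon :: "nat \<Rightarrow> cell set" where
  "ribbon m = {(0, m - 3)} \<union> {(1, j) | j. j < m - 2} \<union> {(2, 0)}"

definition SYT_R :: "nat \<Rightarrow> tableau set" where
  "SYT_R m = SYT (ribbon m)"

text \<open>Promotion restricted to the tableaux of ribbon shape, in the form of an element of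
  \<^term>\<open>BijGroup (SYT_R m)\<close>.\<close>

definition ribbon_promotion :: "nat \<Rightarrow> tableau \<Rightarrow> tableau" where
  "ribbon_promotion m = restrict (promotion (ribbon m)) (SYT_R m)"

definition q_int :: "nat \<Rightarrow> 'a::comm_ring_1 poly" where
  "q_int r = (\<Sum>i<r. [:0, 1:] ^ i)"

text \<open>A bivariate integer polynomial in \<open>q\<close> and \<open>t\<close> is a polynomial in the outer variable \<open>q\<close>
  whose coefficients are polynomials in the inner variable \<open>t\<close>.\<close>

definition eval2 :: "int poly poly \<Rightarrow> complex \<Rightarrow> complex \<Rightarrow> complex" where
  "eval2 f q t = poly (map_poly (\<lambda>p. poly (map_poly of_int p) t) f) q"

definition psi :: "nat \<Rightarrow> int poly poly" where
  "psi m = [:q_int (m - 2):] + of_nat (m - 3) * q_int (m - 1)"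

definition primitive_root_of_unity :: "nat \<Rightarrow> complex \<Rightarrow> bool" where
  "primitive_root_of_unity k z \<longleftrightarrow> 0 < k \<and> z ^ k = 1 \<and> (\<forall>j. 0 < j \<and> j < k \<longrightarrow> z ^ j \<noteq> 1)"

text \<open>\<open>G\<close> and \<open>H\<close> are finite cyclic groups with generators \<open>c\<close> and \<open>d\<close>, and \<open>\<phi>\<close> is an action
  of their product on \<open>X\<close>.  The variable \<open>q\<close> belongs to \<open>G\<close>, the variable \<open>t\<close> to \<open>H\<close>.\<close>

definition bicyclic_sieving ::
  "('g, 'u) monoid_scheme \<Rightarrow> 'g \<Rightarrow> ('h, 'v) monoid_scheme \<Rightarrow> 'h \<Rightarrow>
   'x set \<Rightarrow> ('g \<times> 'h \<Rightarrow> 'x \<Rightarrow> 'x) \<Rightarrow> int poly poly \<Rightarrow> bool" where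
  "bicyclic_sieving G c H d X \<phi> f \<longleftrightarrow>
     group G \<and> finite (carrier G) \<and> c \<in> carrier G \<and> subgroup_generated G {c} = G \<and>
     group H \<and> finite (carrier H) \<and> d \<in> carrier H \<and> subgroup_generated H {d} = H \<and>
     finite X \<and> group_action (G \<times>\<times> H) X \<phi> \<and>
     (\<forall>\<xi> \<zeta>. primitive_root_of_unity (Coset.order G) \<xi> \<longrightarrow>
            primitive_root_of_unity (Coset.order H) \<zeta> \<longrightarrow>
       (\<forall>i j :: int.
          eval2 f (\<xi> powi i) (\<zeta> powi j) =
          of_nat (card {x \<in> X. \<phi> (c [^]\<^bsub>G\<^esub> i, d [^]\<^bsub>H\<^esub> j) x = x})))"

end

theory Submission
  imports Defs
begin

text \<open>A tableau of the ribbon shape is determined by its top entry \<open>a\<close> and its bottom entry \<open>c\<close>,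
  where \<open>1 \<le> a < m\<close>, \<open>2 \<le> c \<le> m\<close>, \<open>a \<noteq> c\<close> and \<open>(a, c)\<close> is neither \<open>(1, 2)\<close> nor \<open>(m - 1, m)\<close>.
  On these pairs promotion decreases both coordinates by one modulo \<open>m - 1\<close>, with \<open>a\<close> read in
  \<open>{1..m - 1}\<close> and \<open>c\<close> in \<open>{2..m}\<close>, except on the cycle
  \<open>(1, m), (m - 2, m - 1), (m - 3, m - 2), \<dots>, (2, 3)\<close> of length \<open>m - 2\<close>.  Off this cycle the
  difference \<open>c - a\<close> modulo \<open>m - 1\<close> is invariant and takes the \<open>m - 3\<close> values \<open>2, \<dots>, m - 2\<close>, each
  on one orbit of size \<open>m - 1\<close>.  The sieving phenomenon needs only these sizes: a power \<open>p\<^sup>n\<close> of a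
  permutation fixes exactly the orbits whose size divides \<open>n\<close>, and \<open>[k]\<^sub>q\<close> at the \<open>n\<close>-th power
  of a primitive \<open>k\<close>-th root of unity is \<open>k\<close> if \<open>k\<close> divides \<open>n\<close> and \<open>0\<close> otherwise.\<close>

section \<open>Powers of a permutation of a finite set\<close>

lemma card_range_periodic:
  fixes f :: "int \<Rightarrow> 'a"
  assumes "0 < l" and period: "\<And>i j. f i = f j \<longleftrightarrow> int l dvd i - j"
  shows "card (range f) = l"
proof -
  have "f i = f (i mod int l)" for i
    by (simp add: period minus_mod_eq_mult_div)
  moreover have "i mod int l \<in> {0..<int l}" for i
    using \<open>0 < l\<close> by simp
  ultimately have "range f = f ` {0..<int l}"
    by blast
  moreover have "inj_on f {0..<int l}"
    by (rule inj_onI) (simp add: period flip: mod_eq_dvd_iff)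
  ultimately show ?thesis
    by (simp add: card_image)
qed

lemma surj_imp_in_carrier_BijGroup:
  assumes "finite X" "f \<in> extensional X" "X \<subseteq> f ` X"
  shows "f \<in> carrier (BijGroup X)"
proof -
  have "X = f ` X"
    using assms by (intro card_seteq finite_imageI card_image_le)
  moreover from this have "inj_on f X"
    using assms(1) by (intro eq_card_imp_inj_on) simp_all
  ultimately show ?thesis
    using assms(2) by (simp add: BijGroup_def Bij_def bij_betw_def)
qed

lemma finite_carrier_BijGroup:
  assumes "finite S"
  shows "finite (carrier (BijGroup S))"
proof (rule finite_subset)
  show "carrier (BijGroup S) \<subseteq> S \<rightarrow>\<^sub>E S"
    by (auto simp: BijGroup_def PiE_def Bij_imp_extensional dest: Bij_imp_funcset)
  show "finite (S \<rightarrow>\<^sub>E S)"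
    using assms by (simp add: finite_PiE)
qed

lemma (in group) hom_mult_subgroup_generated_powers:
  fixes a b :: nat
  assumes x_closed: "x \<in> carrier G"
  shows "(\<lambda>(g, h). g \<otimes> h) \<in>
    hom (subgroup_generated G {x [^] a} \<times>\<times> subgroup_generated G {x [^] b}) G"
proof (rule homI)
  fix u assume "u \<in> carrier (subgroup_generated G {x [^] a} \<times>\<times> subgroup_generated G {x [^] b})"
  then show "(case u of (g, h) \<Rightarrow> g \<otimes> h) \<in> carrier G"
    using carrier_subgroup_generated_subset by (auto simp: DirProd_def)
next
  have powers: "\<exists>i::int. g = x [^] i" if "g \<in> carrier (subgroup_generated G {x [^] l})"
    for g and l :: nat
    using that
    by (auto simp: carrier_subgroup_generated_by_singleton x_closed int_pow_pow
        simp flip: int_pow_int)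
  fix u v
  assume "u \<in> carrier (subgroup_generated G {x [^] a} \<times>\<times> subgroup_generated G {x [^] b})"
    "v \<in> carrier (subgroup_generated G {x [^] a} \<times>\<times> subgroup_generated G {x [^] b})"
  then obtain i j i' j' :: int where "u = (x [^] i, x [^] j)" "v = (x [^] i', x [^] j')"
    using powers by (auto simp: DirProd_def) metis
  then show "(case u \<otimes>\<^bsub>subgroup_generated G {x [^] a} \<times>\<times> subgroup_generated G {x [^] b}\<^esub> v of
      (g, h) \<Rightarrow> g \<otimes> h) = (case u of (g, h) \<Rightarrow> g \<otimes> h) \<otimes> (case v of (g, h) \<Rightarrow> g \<otimes> h)"
    by (simp add: DirProd_def x_closed add_ac flip: int_pow_mult)
qed

locale finite_permutation =
  fixes X :: "'x set" and p :: "'x \<Rightarrow> 'x"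
  assumes finite_X: "finite X" and p_closed: "p \<in> carrier (BijGroup X)"
begin

abbreviation B :: "('x \<Rightarrow> 'x) monoid" where
  "B \<equiv> BijGroup X"

abbreviation p_orbit :: "'x \<Rightarrow> 'x set" where
  "p_orbit \<equiv> orbit (subgroup_generated B {p}) (\<lambda>g. g)"

abbreviation p_orbits :: "'x set set" where
  "p_orbits \<equiv> orbits (subgroup_generated B {p}) X (\<lambda>g. g)"

sublocale B: group B
  by (rule group_BijGroup)

sublocale B_action: group_action "subgroup_generated B {p}" X "\<lambda>g. g"
  by (intro group_action.intro group_hom.intro group_hom_axioms.intro B.group_axioms
      B.group_subgroup_generated B.hom_from_subgroup_generated) (simp add: hom_def)

sublocale iterates: group_action integer_group X "\<lambda>n. p [^]\<^bsub>B\<^esub> n"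
  by (intro group_action.intro group_hom.intro group_hom_axioms.intro group_integer_group
      B.group_axioms B.hom_integer_group_pow p_closed)

lemma p_orbit_eq_range: "p_orbit x = range (\<lambda>n::int. (p [^]\<^bsub>B\<^esub> n) x)"
  by (auto simp: orbit_def B.carrier_subgroup_generated_by_singleton[OF p_closed])

lemma int_pow_apply_in_X: "x \<in> X \<Longrightarrow> (p [^]\<^bsub>B\<^esub> (n::int)) x \<in> X"
  using iterates.element_image by simp

lemma int_pow_add_apply:
  "x \<in> X \<Longrightarrow> (p [^]\<^bsub>B\<^esub> (i + j :: int)) x = (p [^]\<^bsub>B\<^esub> i) ((p [^]\<^bsub>B\<^esub> j) x)"
  using iterates.composition_rule[of x i j] by simp

lemma one_apply: "x \<in> X \<Longrightarrow> \<one>\<^bsub>B\<^esub> x = x"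
  by (simp add: BijGroup_def)

lemma int_pow_apply_eq_iff:
  assumes "x \<in> X"
  shows "(p [^]\<^bsub>B\<^esub> (i::int)) x = (p [^]\<^bsub>B\<^esub> j) x \<longleftrightarrow> (p [^]\<^bsub>B\<^esub> (i - j)) x = x"
proof
  assume "(p [^]\<^bsub>B\<^esub> i) x = (p [^]\<^bsub>B\<^esub> j) x"
  then have "(p [^]\<^bsub>B\<^esub> (- j + i)) x = (p [^]\<^bsub>B\<^esub> (- j + j)) x"
    using assms by (simp only: int_pow_add_apply)
  then show "(p [^]\<^bsub>B\<^esub> (i - j)) x = x"
    using assms one_apply by simp
next
  assume "(p [^]\<^bsub>B\<^esub> (i - j)) x = x"
  then show "(p [^]\<^bsub>B\<^esub> i) x = (p [^]\<^bsub>B\<^esub> j) x"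
    using int_pow_add_apply[OF assms, of j "i - j"] by simp
qed

lemma int_pow_mult_fixes:
  assumes "x \<in> X" "(p [^]\<^bsub>B\<^esub> (l::int)) x = x"
  shows "(p [^]\<^bsub>B\<^esub> (k * l)) x = x"
  using group.subgroup_int_pow_closed[OF group_integer_group iterates.stabilizer_subgroup, of x l k]
    assms by (simp add: stabilizer_def)

lemma ex_positive_int_pow_fixing:
  assumes "x \<in> X"
  obtains l :: nat where "0 < l" "(p [^]\<^bsub>B\<^esub> int l) x = x"
proof -
  have "\<not> inj (\<lambda>n::int. (p [^]\<^bsub>B\<^esub> n) x)"
  proof
    assume "inj (\<lambda>n::int. (p [^]\<^bsub>B\<^esub> n) x)"
    then have "infinite (range (\<lambda>n::int. (p [^]\<^bsub>B\<^esub> n) x))"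
      using infinite_UNIV_int by (simp add: finite_image_iff)
    moreover have "range (\<lambda>n::int. (p [^]\<^bsub>B\<^esub> n) x) \<subseteq> X"
      using int_pow_apply_in_X[OF assms] by blast
    ultimately show False
      using finite_X finite_subset by blast
  qed
  then obtain i j :: int where "j < i" "(p [^]\<^bsub>B\<^esub> i) x = (p [^]\<^bsub>B\<^esub> j) x"
    unfolding inj_def by (metis linorder_neqE)
  then show ?thesis
    using that[of "nat (i - j)"] int_pow_apply_eq_iff[OF assms, of i j] by simp
qed

lemma ex_period:
  assumes "x \<in> X"
  obtains l where "0 < l" "\<And>n::int. (p [^]\<^bsub>B\<^esub> n) x = x \<longleftrightarrow> int l dvd n"
proof -
  define l where "l = (LEAST l. 0 < l \<and> (p [^]\<^bsub>B\<^esub> int l) x = x)"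
  have "\<exists>l. 0 < l \<and> (p [^]\<^bsub>B\<^esub> int l) x = x"
    using ex_positive_int_pow_fixing[OF assms] by blast
  from LeastI_ex[OF this] have l_pos: "0 < l" and l_fixes: "(p [^]\<^bsub>B\<^esub> int l) x = x"
    by (simp_all add: l_def)
  have "int l dvd n" if fixed: "(p [^]\<^bsub>B\<^esub> n) x = x" for n :: int
  proof -
    define r where "r = nat (n mod int l)"
    have r_eq: "int r = n - n div int l * int l" and r_less: "r < l"
      using \<open>0 < l\<close> by (simp_all add: r_def minus_div_mult_eq_mod nat_less_iff)
    have "(p [^]\<^bsub>B\<^esub> int r) x = x"
      unfolding r_eq using fixed int_pow_mult_fixes[OF assms l_fixes]
      by (simp flip: int_pow_apply_eq_iff[OF assms])
    then have "r = 0"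
      using not_less_Least[of r "\<lambda>l. 0 < l \<and> (p [^]\<^bsub>B\<^esub> int l) x = x"] r_less
      by (auto simp: l_def)
    then show ?thesis
      using r_eq by (simp add: minus_div_mult_eq_mod dvd_eq_mod_eq_0)
  qed
  moreover have "(p [^]\<^bsub>B\<^esub> n) x = x" if "int l dvd n" for n
    using that int_pow_mult_fixes[OF assms l_fixes] by (auto elim!: dvdE simp: mult.commute)
  ultimately show ?thesis
    using that[OF l_pos] by blast
qed

lemma int_pow_fixes_iff:
  assumes "x \<in> X"
  shows "(p [^]\<^bsub>B\<^esub> (n::int)) x = x \<longleftrightarrow> int (card (p_orbit x)) dvd n"
proof -
  obtain l where l_pos: "0 < l" and fixes_iff: "\<And>n::int. (p [^]\<^bsub>B\<^esub> n) x = x \<longleftrightarrow> int l dvd n"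
    using ex_period[OF assms] by metis
  have "card (p_orbit x) = l"
    unfolding p_orbit_eq_range
    using l_pos fixes_iff
    by (intro card_range_periodic) (simp_all add: int_pow_apply_eq_iff[OF assms])
  with fixes_iff show ?thesis
    by simp
qed

lemma finite_p_orbits: "finite p_orbits"
  by (simp add: orbits_def finite_X)

lemma finite_p_orbit: "Q \<in> p_orbits \<Longrightarrow> finite Q"
  using B_action.orbits_coverture finite_X by (metis Union_upper finite_subset)

lemma p_orbit_eq_of_mem: "Q \<in> p_orbits \<Longrightarrow> x \<in> Q \<Longrightarrow> x \<in> X \<and> p_orbit x = Q"
  using B_action.orbits_coverture B_action.disjoint_union[of "p_orbit x" Q]
    B_action.orbit_refl[of x]
  by (fastforce simp: orbits_def)

lemma card_fixed_int_pow:
  "card {x \<in> X. (p [^]\<^bsub>B\<^esub> (n::int)) x = x} =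
    (\<Sum>Q\<in>p_orbits. if int (card Q) dvd n then card Q else 0)"
proof -
  have "card {x \<in> X. (p [^]\<^bsub>B\<^esub> n) x = x} = (\<Sum>x\<in>X. if (p [^]\<^bsub>B\<^esub> n) x = x then 1 else 0)"
    by (rule card_as_sums[OF refl finite_X])
  also have "\<dots> = (\<Sum>Q\<in>p_orbits. \<Sum>x\<in>Q. if (p [^]\<^bsub>B\<^esub> n) x = x then 1 else 0)"
    by (rule B_action.disjoint_sum[OF finite_X, symmetric])
  also have "\<dots> = (\<Sum>Q\<in>p_orbits. \<Sum>x\<in>Q. if int (card Q) dvd n then 1 else 0)"
    using p_orbit_eq_of_mem by (intro sum.cong refl) (simp add: int_pow_fixes_iff)
  also have "\<dots> = (\<Sum>Q\<in>p_orbits. if int (card Q) dvd n then card Q else 0)"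
    by (intro sum.cong) auto
  finally show ?thesis .
qed

lemma int_pow_eq_one_iff:
  "p [^]\<^bsub>B\<^esub> (n::int) = \<one>\<^bsub>B\<^esub> \<longleftrightarrow> (\<forall>Q\<in>p_orbits. int (card Q) dvd n)"
proof -
  have "carrier B \<subseteq> extensional X"
    by (auto simp: BijGroup_def Bij_def)
  then have "p [^]\<^bsub>B\<^esub> n \<in> extensional X" "\<one>\<^bsub>B\<^esub> \<in> extensional X"
    using B.int_pow_closed[OF p_closed, of n] B.one_closed by blast+
  then have "p [^]\<^bsub>B\<^esub> n = \<one>\<^bsub>B\<^esub> \<longleftrightarrow> (\<forall>x\<in>X. (p [^]\<^bsub>B\<^esub> n) x = \<one>\<^bsub>B\<^esub> x)"
    by (metis extensionalityI)
  also have "\<dots> \<longleftrightarrow> (\<forall>x\<in>X. int (card (p_orbit x)) dvd n)"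
    by (simp add: one_apply int_pow_fixes_iff)
  finally show ?thesis
    by (auto simp: orbits_def)
qed

lemma ord_eq_Lcm_card_orbits: "B.ord p = Lcm (card ` p_orbits)"
proof -
  have "p [^]\<^bsub>B\<^esub> n = \<one>\<^bsub>B\<^esub> \<longleftrightarrow> Lcm (card ` p_orbits) dvd n" for n :: nat
    using int_pow_eq_one_iff[of "int n"] by (simp add: int_pow_int Lcm_dvd_iff)
  then show ?thesis
    by (simp add: B.ord_unique p_closed)
qed

lemma p_orbit_eq_range_shift:
  fixes f :: "int \<Rightarrow> 'x"
  assumes "\<And>i. f i \<in> X" and shift: "\<And>i. p (f i) = f (i + 1)"
  shows "p_orbit (f i) = range f"
proof -
  have "(p [^]\<^bsub>B\<^esub> (n::int)) (f i) = f (i + n)" for n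
  proof (induction n rule: int_induct[where k = 0])
    case base
    show ?case using assms(1) by (simp add: one_apply)
  next
    case (step1 n)
    then show ?case
      using int_pow_add_apply[OF assms(1), of 1 n i]
      by (simp add: B.int_pow_1[OF p_closed] shift ac_simps)
  next
    case (step2 n)
    have "(p [^]\<^bsub>B\<^esub> (- 1 + n)) (f i) = (p [^]\<^bsub>B\<^esub> (- 1 :: int)) (p (f (i + n - 1)))"
      using int_pow_add_apply[OF assms(1), of "- 1" n i] step2 by (simp add: shift)
    also have "\<dots> = (p [^]\<^bsub>B\<^esub> (- 1 + 1 :: int)) (f (i + n - 1))"
      by (simp only: int_pow_add_apply[OF assms(1)] B.int_pow_1[OF p_closed])
    finally show ?case
      using one_apply[OF assms(1)] by (simp add: algebra_simps)
  qed
  then have "p_orbit (f i) = f ` range ((+) i)"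
    by (simp only: p_orbit_eq_range image_image)
  then show ?thesis by (simp only: surj_plus)
qed

lemma p_orbit_eq_image_cycle:
  assumes "0 < l" "e ` {..<l} \<subseteq> X" and cycle: "\<And>r. r < l \<Longrightarrow> p (e (Suc r mod l)) = e r"
    and "r < l"
  shows "p_orbit (e r) = e ` {..<l}"
proof -
  define s where "s = (\<lambda>i::int. nat (- i mod int l))"
  have s_less: "s i < l" for i
    using \<open>0 < l\<close> by (simp add: s_def nat_less_iff)
  have s_uminus: "s (- int r) = r" if "r < l" for r
    using that by (simp add: s_def)
  have "Suc (s (i + 1)) mod l = s i" for i
  proof -
    have "int (Suc (s (i + 1)) mod l) = (- (i + 1) mod int l + 1) mod int l"
      using \<open>0 < l\<close> by (simp add: s_def zmod_int add.commute)
    also have "\<dots> = int (s i)"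
      using \<open>0 < l\<close> by (simp add: s_def mod_simps)
    finally show ?thesis by simp
  qed
  then have "p (e (s i)) = e (s (i + 1))" for i
    using cycle[OF s_less] by metis
  then have "p_orbit (e (s (- int r))) = range (\<lambda>i. e (s i))"
    using assms(2) s_less by (intro p_orbit_eq_range_shift) auto
  also have "\<dots> = e ` range s"
    by (simp add: image_image)
  also have "range s = {..<l}"
    using s_less s_uminus by (auto simp: image_iff) metis
  finally show ?thesis
    using \<open>r < l\<close> by (simp add: s_uminus)
qed

lemma bicyclic_sieving_powersI:
  fixes a b :: nat
  assumes "\<And>\<xi> \<zeta> i j. primitive_root_of_unity (B.ord (p [^]\<^bsub>B\<^esub> a)) \<xi> \<Longrightarrow>
    primitive_root_of_unity (B.ord (p [^]\<^bsub>B\<^esub> b)) \<zeta> \<Longrightarrow>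
    eval2 f (\<xi> powi i) (\<zeta> powi j) =
      of_nat (card {x \<in> X. (p [^]\<^bsub>B\<^esub> (i * int a + j * int b)) x = x})"
  shows "bicyclic_sieving
    (subgroup_generated B {p [^]\<^bsub>B\<^esub> a}) (p [^]\<^bsub>B\<^esub> a)
    (subgroup_generated B {p [^]\<^bsub>B\<^esub> b}) (p [^]\<^bsub>B\<^esub> b) X (\<lambda>(g, h). g \<otimes>\<^bsub>B\<^esub> h) f"
proof -
  let ?C = "\<lambda>l::nat. subgroup_generated B {p [^]\<^bsub>B\<^esub> l}"
  have in_C: "p [^]\<^bsub>B\<^esub> l \<in> carrier (?C l)" for l :: nat
    using B.subgroup_generated_subset_carrier_subset[of "{p [^]\<^bsub>B\<^esub> l}"] p_closed by simp
  have finite_C: "finite (carrier (?C l))" for l :: nat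
    using finite_carrier_BijGroup[OF finite_X] B.carrier_subgroup_generated_subset
    by (rule rev_finite_subset)
  have order_C: "Coset.order (?C l) = B.ord (p [^]\<^bsub>B\<^esub> l)" for l :: nat
    by (simp add: B.cyclic_order_is_ord p_closed)
  have action: "group_action (?C a \<times>\<times> ?C b) X (\<lambda>(g, h). g \<otimes>\<^bsub>B\<^esub> h)"
    by (intro group_action.intro group_hom.intro group_hom_axioms.intro DirProd_group
        B.group_subgroup_generated B.group_axioms B.hom_mult_subgroup_generated_powers p_closed)
  have power: "(p [^]\<^bsub>B\<^esub> l) [^]\<^bsub>?C l\<^esub> i = p [^]\<^bsub>B\<^esub> (i * int l)" for l :: nat and i :: int
  proof -
    have "(p [^]\<^bsub>B\<^esub> l) [^]\<^bsub>?C l\<^esub> i = (p [^]\<^bsub>B\<^esub> int l) [^]\<^bsub>B\<^esub> i"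
      by (simp add: B.int_pow_subgroup_generated[OF in_C] int_pow_int)
    then show ?thesis
      by (simp add: B.int_pow_pow p_closed mult.commute)
  qed
  show ?thesis
    unfolding bicyclic_sieving_def order_C
    using in_C finite_C action assms by (simp add: finite_X power B.int_pow_mult p_closed)
qed

end

section \<open>q-integers at roots of unity\<close>

lemma map_poly_add:
  assumes "f 0 = 0" "\<And>a b. f (a + b) = f a + f b"
  shows "map_poly f (p + q) = map_poly f p + map_poly f q"
  using assms by (intro poly_eqI) (simp add: coeff_map_poly)

lemma eval2_0: "eval2 0 q t = 0"
  by (simp add: eval2_def)

lemma eval2_add: "eval2 (f + g) q t = eval2 f q t + eval2 g q t"
  by (simp add: eval2_def map_poly_add)

lemma eval2_of_nat_mult: "eval2 (of_nat n * f) q t = of_nat n * eval2 f q t"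
  by (induction n) (simp_all add: eval2_0 eval2_add distrib_right)

lemma q_int_0: "q_int 0 = 0"
  and q_int_Suc: "q_int (Suc r) = q_int r + monom 1 r"
  by (simp_all add: q_int_def monom_altdef)

lemma eval2_q_int: "eval2 (q_int r) q t = (\<Sum>i<r. q ^ i)"
proof (induction r)
  case (Suc r)
  have "eval2 (monom 1 r) q t = q ^ r"
    by (simp add: eval2_def map_poly_monom poly_monom)
  with Suc show ?case
    by (simp add: q_int_Suc eval2_add)
qed (simp add: q_int_0 eval2_0)

lemma eval2_const_q_int: "eval2 [:q_int r:] q t = (\<Sum>i<r. t ^ i)"
proof (induction r)
  case (Suc r)
  have "[:q_int (Suc r) :: int poly:] = [:q_int r:] + [:monom 1 r:]"
    by (simp add: q_int_Suc)
  moreover have "eval2 [:monom 1 r:] q t = t ^ r"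
    by (simp add: eval2_def map_poly_pCons map_poly_monom poly_monom)
  ultimately show ?case
    by (simp only: eval2_add Suc.IH sum.lessThan_Suc)
qed (simp add: q_int_0 eval2_0)

lemma primitive_root_powi_eq_1_iff:
  assumes "primitive_root_of_unity k z"
  shows "z powi s = 1 \<longleftrightarrow> int k dvd s"
proof -
  have k_pos: "0 < k" and z_pow_k: "z ^ k = 1" and minimal: "\<And>j. 0 < j \<Longrightarrow> j < k \<Longrightarrow> z ^ j \<noteq> 1"
    using assms by (auto simp: primitive_root_of_unity_def)
  have "z \<noteq> 0" using k_pos z_pow_k by (auto simp: power_0_left)
  define j where "j = nat (s mod int k)"
  have int_j: "int j = s mod int k" and j_less: "j < k"
    using k_pos by (auto simp: j_def nat_less_iff)
  have "z powi s = z powi (int k * (s div int k) + int j)"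
    using int_j by simp
  also have "\<dots> = z powi (int k * (s div int k)) * z powi (int j)"
    using \<open>z \<noteq> 0\<close> by (intro power_int_add) auto
  also have "\<dots> = z ^ j"
    using z_pow_k by (simp add: power_int_mult)
  finally have "z powi s = z ^ j" .
  moreover have "z ^ j = 1 \<longleftrightarrow> j = 0"
    using minimal j_less by (cases "j = 0") auto
  ultimately show ?thesis
    by (simp add: dvd_eq_mod_eq_0 flip: int_j)
qed

lemma sum_powers_primitive_root:
  assumes "primitive_root_of_unity k z"
  shows "(\<Sum>i<k. (z powi s) ^ i) = (if int k dvd s then of_nat k else 0)"
proof -
  have "(z powi s) ^ k = (z ^ k) powi s"
    by (metis mult.commute power_int_mult power_int_of_nat)
  also have "\<dots> = 1"
    using assms by (simp add: primitive_root_of_unity_def)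
  finally have "z powi s \<noteq> 1 \<Longrightarrow> (\<Sum>i<k. (z powi s) ^ i) = 0"
    by (simp add: geometric_sum)
  then show ?thesis
    by (auto simp flip: primitive_root_powi_eq_1_iff[OF assms])
qed

section \<open>Bicyclic sieving for two coprime orbit sizes\<close>

locale two_coprime_orbit_sizes = finite_permutation +
  fixes a b :: nat
  assumes card_p_orbits: "card ` p_orbits = {a, b}"
    and coprime_sizes: "coprime a b" and sizes_neq: "a \<noteq> b"
begin

definition orbit_size_poly :: "int poly poly" where
  "orbit_size_poly =
     of_nat (card {Q \<in> p_orbits. card Q = a}) * [:q_int a:] +
     of_nat (card {Q \<in> p_orbits. card Q = b}) * q_int b"

lemma sizes_pos: "0 < a" "0 < b"
proof -
  have "0 < card Q" if "Q \<in> p_orbits" for Q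
  proof -
    have "Q \<noteq> {}"
      using that B_action.orbit_refl by (fastforce simp: orbits_def)
    then show ?thesis
      using finite_p_orbit[OF that] by (simp add: card_gt_0_iff)
  qed
  then have "\<forall>n\<in>card ` p_orbits. 0 < n" by blast
  then show "0 < a" "0 < b"
    by (simp_all add: card_p_orbits)
qed

lemma ord_eq_mult: "B.ord p = a * b"
  using coprime_sizes by (simp add: ord_eq_Lcm_card_orbits card_p_orbits lcm_coprime)

lemma ord_power_sizes: "B.ord (p [^]\<^bsub>B\<^esub> a) = b" "B.ord (p [^]\<^bsub>B\<^esub> b) = a"
  using sizes_pos by (simp_all add: B.ord_pow p_closed ord_eq_mult)

lemma card_fixed_by_sizes:
  "card {x \<in> X. (p [^]\<^bsub>B\<^esub> (n::int)) x = x} =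
    card {Q \<in> p_orbits. card Q = a} * (if int a dvd n then a else 0) +
    card {Q \<in> p_orbits. card Q = b} * (if int b dvd n then b else 0)"
proof -
  let ?fixed = "\<lambda>l. if int l dvd n then l else 0"
  have "{Q \<in> p_orbits. card Q = a} \<union> {Q \<in> p_orbits. card Q = b} = p_orbits"
    using card_p_orbits by blast
  then have "card {x \<in> X. (p [^]\<^bsub>B\<^esub> n) x = x} =
      (\<Sum>Q\<in>{Q \<in> p_orbits. card Q = a} \<union> {Q \<in> p_orbits. card Q = b}. ?fixed (card Q))"
    by (simp only: card_fixed_int_pow)
  also have "\<dots> = (\<Sum>Q\<in>{Q \<in> p_orbits. card Q = a}. ?fixed (card Q)) +
      (\<Sum>Q\<in>{Q \<in> p_orbits. card Q = b}. ?fixed (card Q))"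
    using sizes_neq by (intro sum.union_disjoint) (auto simp: finite_p_orbits)
  finally show ?thesis by simp
qed

lemma eval2_orbit_size_poly:
  assumes "primitive_root_of_unity b \<xi>" "primitive_root_of_unity a \<zeta>"
  shows "eval2 orbit_size_poly (\<xi> powi r) (\<zeta> powi s) =
    of_nat (card {x \<in> X. (p [^]\<^bsub>B\<^esub> (r * int a + s * int b)) x = x})"
proof -
  have "int a dvd r * int a + s * int b \<longleftrightarrow> int a dvd s"
    "int b dvd r * int a + s * int b \<longleftrightarrow> int b dvd r"
    using coprime_sizes
    by (simp_all add: dvd_add_right_iff dvd_add_left_iff coprime_dvd_mult_left_iff coprime_commute)
  then show ?thesis
    unfolding orbit_size_poly_def card_fixed_by_sizes eval2_add eval2_of_nat_mult eval2_q_int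
      eval2_const_q_int sum_powers_primitive_root[OF assms(1)]
      sum_powers_primitive_root[OF assms(2)]
    by simp
qed

theorem bicyclic_sieving_orbit_size_poly:
  "bicyclic_sieving
    (subgroup_generated B {p [^]\<^bsub>B\<^esub> a}) (p [^]\<^bsub>B\<^esub> a)
    (subgroup_generated B {p [^]\<^bsub>B\<^esub> b}) (p [^]\<^bsub>B\<^esub> b) X (\<lambda>(g, h). g \<otimes>\<^bsub>B\<^esub> h) orbit_size_poly"
  by (rule bicyclic_sieving_powersI) (simp only: ord_power_sizes eval2_orbit_size_poly)

end

section \<open>Standard Young tableaux of ribbon shape\<close>

declare One_nat_def [simp del]

lemma mem_ribbon:
  "x \<in> ribbon m \<longleftrightarrow> x = (0, m - 3) \<or> (fst x = 1 \<and> snd x < m - 2) \<or> x = (2, 0)"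
  by (cases x) (auto simp: ribbon_def)

lemma ribbon_cases [consumes 1, case_names top middle bottom]:
  assumes "x \<in> ribbon m"
  obtains "x = (0, m - 3)" | j where "x = (1, j)" "j < m - 2" | "x = (2, 0)"
  using assms by (cases x) (auto simp: mem_ribbon)

lemma ribbon_eq_insert: "ribbon m = insert (0, m - 3) (insert (2, 0) (Pair 1 ` {..<m - 2}))"
  by (auto simp: mem_ribbon)

lemma finite_ribbon: "finite (ribbon m)"
  by (simp add: ribbon_eq_insert)

lemma card_ribbon:
  assumes "m > 3"
  shows "card (ribbon m) = m"
proof -
  have "card (Pair (1::nat) ` {..<m - 2}) = m - 2"
    by (simp add: card_image inj_on_def)
  then show ?thesis
    using assms by (auto simp: ribbon_eq_insert card_insert_if)
qed

lemma SYT_R_iff: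
  assumes "m > 3"
  shows "T \<in> SYT_R m \<longleftrightarrow> T \<in> extensional (ribbon m) \<and> bij_betw T (ribbon m) {1..m} \<and>
    (\<forall>i j. i < j \<longrightarrow> j < m - 2 \<longrightarrow> T (1, i) < T (1, j)) \<and>
    T (0, m - 3) < T (1, m - 3) \<and> T (1, 0) < T (2, 0)"
proof -
  have row: "(\<forall>i j j'. (i, j) \<in> ribbon m \<longrightarrow> (i, j') \<in> ribbon m \<longrightarrow> j < j' \<longrightarrow> T (i, j) < T (i, j'))
      \<longleftrightarrow> (\<forall>i j. i < j \<longrightarrow> j < m - 2 \<longrightarrow> T (1, i) < T (1, j))"
    by (auto simp: mem_ribbon)
  have col: "(\<forall>i i' j. (i, j) \<in> ribbon m \<longrightarrow> (i', j) \<in> ribbon m \<longrightarrow> i < i' \<longrightarrow> T (i, j) < T (i', j))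
      \<longleftrightarrow> T (0, m - 3) < T (1, m - 3) \<and> T (1, 0) < T (2, 0)" (is "?col \<longleftrightarrow> _")
  proof
    assume ?col
    then show "T (0, m - 3) < T (1, m - 3) \<and> T (1, 0) < T (2, 0)"
      using assms spec[OF \<open>?col\<close>, of 0] spec[OF \<open>?col\<close>, of 1] by (auto simp: mem_ribbon)
  qed (use assms in \<open>auto simp: mem_ribbon\<close>)
  show ?thesis
    by (simp only: SYT_R_def SYT_def card_ribbon[OF assms] mem_Collect_eq row col)
qed

text \<open>The \<open>j\<close>-th smallest positive integer other than \<open>a\<close> and \<open>c\<close>, counted from \<open>j = 0\<close>.\<close>

definition mid_entry :: "nat \<Rightarrow> nat \<Rightarrow> nat \<Rightarrow> nat" where
  "mid_entry a c j =
     (if j + 1 < min a c then j + 1 else if j + 2 < max a c then j + 2 else j + 3)"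

definition ribbon_tableau :: "nat \<Rightarrow> nat \<times> nat \<Rightarrow> tableau" where
  "ribbon_tableau m = (\<lambda>(a, c). \<lambda>x\<in>ribbon m.
     if fst x = 0 then a else if fst x = 2 then c else mid_entry a c (snd x))"

definition end_pairs :: "nat \<Rightarrow> (nat \<times> nat) set" where
  "end_pairs m = {(a, c). 1 \<le> a \<and> a < m \<and> 2 \<le> c \<and> c \<le> m \<and> a \<noteq> c \<and>
     (a, c) \<noteq> (m - 1, m) \<and> (a, c) \<noteq> (1, 2)}"

lemma mid_entry_strict_mono: "i < j \<Longrightarrow> mid_entry a c i < mid_entry a c j"
  by (auto simp: mid_entry_def)

lemma mid_entry_Suc: "mid_entry (Suc a) (Suc c) (Suc j) = Suc (mid_entry a c j)"
  by (simp add: mid_entry_def)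

lemma mid_entry_image:
  assumes "a \<noteq> c" "a \<in> {1..m}" "c \<in> {1..m}"
  shows "mid_entry a c ` {..<m - 2} = {1..m} - {a, c}"
proof (rule card_subset_eq)
  have "inj_on (mid_entry a c) {..<m - 2}"
    by (rule linorder_inj_onI') (metis less_irrefl mid_entry_strict_mono)
  then have "card (mid_entry a c ` {..<m - 2}) = m - 2"
    by (simp add: card_image)
  then show "card (mid_entry a c ` {..<m - 2}) = card ({1..m} - {a, c})"
    using assms by (subst card_Diff_subset) auto
  show "mid_entry a c ` {..<m - 2} \<subseteq> {1..m} - {a, c}"
    using assms by (auto simp: mid_entry_def min_def max_def split: if_splits)
qed auto

lemma end_pairs_iff_mid_entry:
  assumes "m > 3"
  shows "(a, c) \<in> end_pairs m \<longleftrightarrow> a \<noteq> c \<and> a \<in> {1..m} \<and> c \<in> {1..m} \<and>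
    a < mid_entry a c (m - 3) \<and> mid_entry a c 0 < c"
  using assms by (auto simp: end_pairs_def mid_entry_def min_def max_def split: if_splits)

lemma ribbon_tableau_top: "ribbon_tableau m (a, c) (0, m - 3) = a"
  and ribbon_tableau_bottom: "ribbon_tableau m (a, c) (2, 0) = c"
  and ribbon_tableau_middle:
    "j < m - 2 \<Longrightarrow> ribbon_tableau m (a, c) (1, j) = mid_entry a c j"
  by (auto simp: ribbon_tableau_def mem_ribbon)

lemmas ribbon_tableau_simps = ribbon_tableau_top ribbon_tableau_bottom ribbon_tableau_middle

lemma ribbon_tableau_extensional: "ribbon_tableau m x \<in> extensional (ribbon m)"
  by (simp add: ribbon_tableau_def split: prod.split)

lemma inj_ribbon_tableau: "inj (ribbon_tableau m)"
proof (rule injI)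
  fix x y :: "nat \<times> nat"
  assume "ribbon_tableau m x = ribbon_tableau m y"
  then show "x = y"
    by (cases x; cases y) (metis ribbon_tableau_top ribbon_tableau_bottom)
qed

lemma bij_betw_ribbon_tableau:
  assumes m_gt_3: "m > 3" and ends: "a \<noteq> c" "a \<in> {1..m}" "c \<in> {1..m}"
  shows "bij_betw (ribbon_tableau m (a, c)) (ribbon m) {1..m}"
proof -
  let ?T = "ribbon_tableau m (a, c)"
  have "?T ` Pair 1 ` {..<m - 2} = mid_entry a c ` {..<m - 2}"
    by (simp add: image_image ribbon_tableau_middle)
  then have "?T ` ribbon m = insert a (insert c ({1..m} - {a, c}))"
    by (simp add: ribbon_eq_insert ribbon_tableau_top ribbon_tableau_bottom
        mid_entry_image[OF ends])
  then have "?T ` ribbon m = {1..m}"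
    using ends by auto
  moreover from this have "inj_on ?T (ribbon m)"
    by (intro eq_card_imp_inj_on finite_ribbon) (simp add: card_ribbon[OF m_gt_3])
  ultimately show ?thesis
    by (simp add: bij_betw_def)
qed

lemma ribbon_tableau_in_SYT_R:
  assumes "m > 3" "(a, c) \<in> end_pairs m"
  shows "ribbon_tableau m (a, c) \<in> SYT_R m"
  using assms
  by (simp add: SYT_R_iff end_pairs_iff_mid_entry bij_betw_ribbon_tableau ribbon_tableau_extensional
      ribbon_tableau_simps mid_entry_strict_mono)

lemma SYT_R_ends:
  assumes "m > 3" "T \<in> SYT_R m"
  shows "T (0, m - 3) \<noteq> T (2, 0)" "T (0, m - 3) \<in> {1..m}" "T (2, 0) \<in> {1..m}"
proof -
  have cells: "(0, m - 3) \<in> ribbon m" "(2, 0) \<in> ribbon m"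
    by (simp_all add: mem_ribbon)
  have bij: "bij_betw T (ribbon m) {1..m}"
    using assms by (simp add: SYT_R_iff)
  then show "T (0, m - 3) \<noteq> T (2, 0)"
    using inj_on_eq_iff[OF bij_betw_imp_inj_on cells] by simp
  show "T (0, m - 3) \<in> {1..m}" "T (2, 0) \<in> {1..m}"
    using bij_betwE[OF bij] cells by blast+
qed

lemma SYT_R_middle:
  assumes "m > 3" "T \<in> SYT_R m" "j < m - 2"
  shows "T (1, j) = mid_entry (T (0, m - 3)) (T (2, 0)) j"
proof -
  let ?mid = "mid_entry (T (0, m - 3)) (T (2, 0))"
  have bij: "bij_betw T (ribbon m) {1..m}"
    and row: "\<And>i j. i < j \<Longrightarrow> j < m - 2 \<Longrightarrow> T (1, i) < T (1, j)"
    using assms(1,2) by (simp_all add: SYT_R_iff)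
  have "(\<lambda>j. T (1, j)) ` {..<m - 2} = T ` (ribbon m - {(0, m - 3), (2, 0)})"
    by (auto simp: mem_ribbon image_iff)
  also have "\<dots> = T ` ribbon m - T ` {(0, m - 3), (2, 0)}"
    using bij by (intro inj_on_image_set_diff) (auto simp: bij_betw_def mem_ribbon)
  also have "\<dots> = ?mid ` {..<m - 2}"
    using bij by (simp add: mid_entry_image[OF SYT_R_ends[OF assms(1,2)]] bij_betw_def)
  finally have "map (\<lambda>j. T (1, j)) [0..<m - 2] = map ?mid [0..<m - 2]"
    by (intro strict_sorted_equal)
      (simp_all add: sorted_wrt_iff_nth_less row mid_entry_strict_mono atLeast0LessThan)
  then show ?thesis
    using assms(3) by (simp add: list_eq_iff_nth_eq)
qed

lemma SYT_R_eq_image: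
  assumes m_gt_3: "m > 3"
  shows "SYT_R m = ribbon_tableau m ` end_pairs m"
proof
  show "SYT_R m \<subseteq> ribbon_tableau m ` end_pairs m"
  proof
    fix T assume T_in_SYT_R: "T \<in> SYT_R m"
    let ?x = "(T (0, m - 3), T (2, 0))"
    have "T = ribbon_tableau m ?x"
    proof (rule extensionalityI[OF _ ribbon_tableau_extensional])
      show "T \<in> extensional (ribbon m)"
        using m_gt_3 T_in_SYT_R by (simp add: SYT_R_iff)
      show "T x = ribbon_tableau m ?x x" if "x \<in> ribbon m" for x
        using that
        by (cases rule: ribbon_cases)
          (simp_all add: ribbon_tableau_simps SYT_R_middle[OF m_gt_3 T_in_SYT_R])
    qed
    moreover have "?x \<in> end_pairs m"
      using m_gt_3 T_in_SYT_R SYT_R_ends[OF m_gt_3 T_in_SYT_R]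
      by (simp add: end_pairs_iff_mid_entry SYT_R_iff flip: SYT_R_middle)
    ultimately show "T \<in> ribbon_tableau m ` end_pairs m"
      by blast
  qed
qed (auto simp: ribbon_tableau_in_SYT_R[OF m_gt_3])

section \<open>Promotion of ribbon tableaux\<close>

lemma arg_min_on_singleton:
  fixes f :: "'a \<Rightarrow> 'b::order"
  shows "arg_min_on f {x} = x"
  using arg_min_if_finite(1)[of "{x}" f] by simp

lemma arg_min_on_doubleton:
  fixes f :: "'a \<Rightarrow> 'b::order"
  assumes "f x < f y"
  shows "arg_min_on f {x, y} = x"
  using arg_min_if_finite[of "{x, y}" f] assms by auto

lemma slide_stop: "right_lower_neighbours D d = {} \<Longrightarrow> slide D (T, d) = (T, d)"
  by (simp add: slide_def while_unfold)

lemma slide_move: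
  assumes "right_lower_neighbours D d \<noteq> {}" "arg_min_on T (right_lower_neighbours D d) = n"
  shows "slide D (T, d) = slide D (T(d := T n), n)"
  unfolding slide_def
  by (subst while_unfold) (simp add: assms slide_step_def)

lemma slide_move_unique:
  assumes "right_lower_neighbours D d = {n}"
  shows "slide D (T, d) = slide D (T(d := T n), n)"
  by (rule slide_move) (simp_all add: assms arg_min_on_singleton)

lemma promotion_eqI:
  assumes "inj_on T D" "d \<in> D" "T d = 1" "slide D (T, d) = (T', d')" "U \<in> extensional D"
    and entries: "\<And>x. x \<in> D \<Longrightarrow> (if x = d' then card D else T' x - 1) = U x"
  shows "promotion D T = U"
proof (rule extensionalityI[OF _ \<open>U \<in> extensional D\<close>])
  have "promotion D T = (\<lambda>x\<in>D. if x = d' then card D else T' x - 1)"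
    by (simp add: promotion_def the_inv_into_f_eq[OF assms(1,3,2)] assms(4))
  then show "promotion D T \<in> extensional D" "\<And>x. x \<in> D \<Longrightarrow> promotion D T x = U x"
    by (simp_all add: entries)
qed

context
  fixes m :: nat
  assumes m_gt_3: "m > 3"
begin

lemma neighbours_top: "right_lower_neighbours (ribbon m) (0, m - 3) = {(1, m - 3)}"
  and neighbours_corner: "right_lower_neighbours (ribbon m) (1, 0) = {(1, 1), (2, 0)}"
  and neighbours_bottom: "right_lower_neighbours (ribbon m) (2, 0) = {}"
  and neighbours_middle:
    "0 < j \<Longrightarrow> right_lower_neighbours (ribbon m) (1, j) = (if j < m - 3 then {(1, Suc j)} else {})"
  using m_gt_3 by (auto simp: right_lower_neighbours_def mem_ribbon One_nat_def)

lemma slide_top: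
  "slide (ribbon m) (T, (0, m - 3)) = (T((0, m - 3) := T (1, m - 3)), (1, m - 3))"
  using m_gt_3 by (simp add: slide_move_unique[OF neighbours_top] slide_stop neighbours_middle)

lemma slide_corner_down:
  assumes "T (2, 0) < T (1, 1)"
  shows "slide (ribbon m) (T, (1, 0)) = (T((1, 0) := T (2, 0)), (2, 0))"
proof -
  have "arg_min_on T (right_lower_neighbours (ribbon m) (1, 0)) = (2, 0)"
    using arg_min_on_doubleton[of T, OF assms] by (simp add: neighbours_corner insert_commute)
  then show ?thesis
    by (simp add: slide_move neighbours_corner slide_stop neighbours_bottom)
qed

lemma slide_middle:
  assumes "0 < j" "j \<le> m - 3"
  shows "slide (ribbon m) (T, (1, j)) =
    ((\<lambda>x. if fst x = 1 \<and> j \<le> snd x \<and> snd x < m - 3 then T (1, Suc (snd x)) else T x), (1, m - 3))"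
  using assms
proof (induction "m - 3 - j" arbitrary: j T)
  case 0
  then have "j = m - 3" by simp
  with 0 show ?case
    by (simp add: slide_stop neighbours_middle fun_eq_iff)
next
  case (Suc n)
  then have j_less: "j < m - 3" by simp
  then have "slide (ribbon m) (T, (1, j)) =
      slide (ribbon m) (T((1, j) := T (1, Suc j)), (1, Suc j))"
    using Suc.prems by (intro slide_move_unique) (simp add: neighbours_middle)
  also have "\<dots> = ((\<lambda>x. if fst x = 1 \<and> j \<le> snd x \<and> snd x < m - 3
      then T (1, Suc (snd x)) else T x), (1, m - 3))"
    using Suc.hyps(2) j_less by (subst Suc.hyps(1)) (auto simp: fun_eq_iff)
  finally show ?case .
qed

lemma slide_corner_right:
  assumes "T (1, 1) < T (2, 0)"
  shows "slide (ribbon m) (T, (1, 0)) =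
    ((\<lambda>x. if fst x = 1 \<and> snd x < m - 3 then T (1, Suc (snd x)) else T x), (1, m - 3))"
proof -
  have "arg_min_on T (right_lower_neighbours (ribbon m) (1, 0)) = (1, 1)"
    using arg_min_on_doubleton[of T, OF assms] by (simp add: neighbours_corner)
  then have "slide (ribbon m) (T, (1, 0)) = slide (ribbon m) (T((1, 0) := T (1, 1)), (1, 1))"
    by (simp add: slide_move neighbours_corner)
  also have "\<dots> =
    ((\<lambda>x. if fst x = 1 \<and> snd x < m - 3 then T (1, Suc (snd x)) else T x), (1, m - 3))"
    using m_gt_3 by (subst slide_middle) (auto simp: fun_eq_iff simp flip: One_nat_def)
  finally show ?thesis .
qed

lemma promotion_ribbon_tableau_eqI:
  assumes "(a, c) \<in> end_pairs m" "d \<in> ribbon m" "ribbon_tableau m (a, c) d = 1"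
    and "slide (ribbon m) (ribbon_tableau m (a, c), d) = (T', d')"
    and "\<And>x. x \<in> ribbon m \<Longrightarrow> (if x = d' then m else T' x - 1) = ribbon_tableau m y x"
  shows "promotion (ribbon m) (ribbon_tableau m (a, c)) = ribbon_tableau m y"
proof (rule promotion_eqI[OF _ assms(2-4) ribbon_tableau_extensional])
  show "inj_on (ribbon_tableau m (a, c)) (ribbon m)"
    using ribbon_tableau_in_SYT_R[OF m_gt_3 assms(1)]
    by (simp add: SYT_R_iff[OF m_gt_3] bij_betw_def)
qed (simp only: card_ribbon[OF m_gt_3] assms(5))

lemma promotion_from_top:
  assumes "(1, c) \<in> end_pairs m"
  shows "promotion (ribbon m) (ribbon_tableau m (1, c)) =
    ribbon_tableau m (if c = m then (m - 2, m - 1) else (m - 1, c - 1))"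
proof (rule promotion_ribbon_tableau_eqI[OF assms _ _ slide_top])
  have c_bounds: "3 \<le> c" "c \<le> m"
    using assms by (auto simp: end_pairs_def)
  fix x assume "x \<in> ribbon m"
  then show "(if x = (1, m - 3) then m else
      ((ribbon_tableau m (1, c))((0, m - 3) := ribbon_tableau m (1, c) (1, m - 3))) x - 1) =
    ribbon_tableau m (if c = m then (m - 2, m - 1) else (m - 1, c - 1)) x"
    by (cases rule: ribbon_cases)
      (use c_bounds m_gt_3 in \<open>auto simp: ribbon_tableau_simps mid_entry_def min_def max_def\<close>)
qed (simp_all add: mem_ribbon ribbon_tableau_top)

lemma ribbon_tableau_corner:
  assumes "(a, c) \<in> end_pairs m" "a \<noteq> 1"
  shows "ribbon_tableau m (a, c) (1, 0) = 1"
  using assms m_gt_3 by (auto simp: ribbon_tableau_middle end_pairs_def mid_entry_def)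

lemma promotion_down:
  assumes ends: "(a, c) \<in> end_pairs m" "a \<noteq> 1" and down: "c = 2 \<or> (a, c) = (2, 3)"
  shows "promotion (ribbon m) (ribbon_tableau m (a, c)) = ribbon_tableau m (a - 1, m)"
proof (rule promotion_ribbon_tableau_eqI[OF ends(1) _ ribbon_tableau_corner[OF ends]
      slide_corner_down])
  have bounds: "1 < a" "a < m" "a \<noteq> c"
    using ends by (auto simp: end_pairs_def)
  show "ribbon_tableau m (a, c) (2, 0) < ribbon_tableau m (a, c) (1, 1)"
    using bounds down m_gt_3 by (auto simp: ribbon_tableau_simps mid_entry_def)
  fix x assume "x \<in> ribbon m"
  then show "(if x = (2, 0) then m else
      ((ribbon_tableau m (a, c))((1, 0) := ribbon_tableau m (a, c) (2, 0))) x - 1) =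
    ribbon_tableau m (a - 1, m) x"
  proof (cases rule: ribbon_cases)
    case (middle j)
    have "c - 1 = mid_entry (a - 1) m 0"
      using bounds down m_gt_3 by (auto simp: mid_entry_def)
    moreover have "mid_entry a c j - 1 = mid_entry (a - 1) m j" if "j \<noteq> 0"
      using bounds down \<open>j < m - 2\<close> that by (auto simp: mid_entry_def min_def max_def)
    ultimately show ?thesis
      using middle by (auto simp: ribbon_tableau_simps)
  qed (simp_all add: ribbon_tableau_simps)
qed (use m_gt_3 in \<open>simp add: mem_ribbon\<close>)

lemma promotion_right:
  assumes ends: "(a, c) \<in> end_pairs m" "a \<noteq> 1" and right: "c \<noteq> 2" "(a, c) \<noteq> (2, 3)"
  shows "promotion (ribbon m) (ribbon_tableau m (a, c)) = ribbon_tableau m (a - 1, c - 1)"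
proof (rule promotion_ribbon_tableau_eqI[OF ends(1) _ ribbon_tableau_corner[OF ends]
      slide_corner_right])
  have bounds: "1 < a" "a < m" "2 < c" "c \<le> m" "a \<noteq> c" "\<not> (a = m - 1 \<and> c = m)"
    using ends right by (auto simp: end_pairs_def)
  show "ribbon_tableau m (a, c) (1, 1) < ribbon_tableau m (a, c) (2, 0)"
    using bounds right m_gt_3 by (auto simp: ribbon_tableau_simps mid_entry_def)
  fix x assume "x \<in> ribbon m"
  then show "(if x = (1, m - 3) then m else (if fst x = 1 \<and> snd x < m - 3
      then ribbon_tableau m (a, c) (1, Suc (snd x)) else ribbon_tableau m (a, c) x) - 1) =
    ribbon_tableau m (a - 1, c - 1) x"
  proof (cases rule: ribbon_cases)
    case (middle j)
    have "mid_entry a c (Suc j) - 1 = mid_entry (a - 1) (c - 1) j"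
      using bounds mid_entry_Suc[of "a - 1" "c - 1" j] by simp
    moreover have "mid_entry (a - 1) (c - 1) (m - 3) = m"
      using bounds m_gt_3 by (auto simp: mid_entry_def)
    ultimately show ?thesis
      using middle by (auto simp: ribbon_tableau_simps)
  qed (simp_all add: ribbon_tableau_simps)
qed (use m_gt_3 in \<open>simp add: mem_ribbon\<close>)

end

definition pair_promotion :: "nat \<Rightarrow> nat \<times> nat \<Rightarrow> nat \<times> nat" where
  "pair_promotion m = (\<lambda>(a, c).
     if a = 1 then (if c = m then (m - 2, m - 1) else (m - 1, c - 1))
     else if c = 2 \<or> (a, c) = (2, 3) then (a - 1, m)
     else (a - 1, c - 1))"

lemma promotion_ribbon_tableau:
  assumes "m > 3" "x \<in> end_pairs m"
  shows "promotion (ribbon m) (ribbon_tableau m x) = ribbon_tableau m (pair_promotion m x)"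
  using assms
  by (cases x; cases "fst x = 1")
    (auto simp: pair_promotion_def promotion_from_top promotion_down promotion_right)

section \<open>Orbits of ribbon promotion\<close>

definition orbit_length :: "nat \<Rightarrow> nat \<Rightarrow> nat" where
  "orbit_length m k = (if k = 0 then m - 2 else m - 1)"

text \<open>Orbit \<open>0\<close> is the exceptional cycle; on orbit \<open>k\<close> one has \<open>c - a \<equiv> k + 1\<close> modulo \<open>m - 1\<close>,
  except at the pair \<open>(1, m)\<close>.  Promotion decreases \<open>r\<close>.\<close>

definition orbit_pair :: "nat \<Rightarrow> nat \<Rightarrow> nat \<Rightarrow> nat \<times> nat" where
  "orbit_pair m k r =
     (if k = 0 \<and> r = 0 then (1, m)
      else (r + 1, if r + k + 2 \<le> m then r + k + 2 else r + k + 3 - m))"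

lemma end_pairs_obtain_orbit_pair:
  assumes "m > 3" "(a, c) \<in> end_pairs m"
  obtains k r where "k < m - 2" "r < orbit_length m k" "(a, c) = orbit_pair m k r"
proof -
  have ends: "1 \<le> a" "a < m" "2 \<le> c" "c \<le> m" "a \<noteq> c"
    "\<not> (a = m - 1 \<and> c = m)" "\<not> (a = 1 \<and> c = 2)"
    using assms(2) by (auto simp: end_pairs_def)
  consider (extreme) "a = 1" "c = m" | (adjacent) "c = a + 1"
    | (ascending) "a + 1 < c" "\<not> (a = 1 \<and> c = m)" | (descending) "c < a"
    using ends by linarith
  then show ?thesis
  proof cases
    case extreme
    then show ?thesis
      using assms(1) by (intro that[of 0 0]) (auto simp: orbit_length_def orbit_pair_def)
  next
    case adjacent
    then show ?thesis
      using assms(1) ends by (intro that[of 0 "a - 1"]) (auto simp: orbit_length_def orbit_pair_def)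
  next
    case ascending
    then show ?thesis
      using assms(1) ends
      by (intro that[of "c - a - 1" "a - 1"]) (auto simp: orbit_length_def orbit_pair_def)
  next
    case descending
    then show ?thesis
      using assms(1) ends
      by (intro that[of "c + m - 2 - a" "a - 1"]) (auto simp: orbit_length_def orbit_pair_def)
  qed
qed

lemma orbit_pair_in_end_pairs:
  assumes "m > 3" "k < m - 2" "r < orbit_length m k"
  shows "orbit_pair m k r \<in> end_pairs m"
  using assms
  by (auto simp: orbit_pair_def end_pairs_def orbit_length_def split: if_splits)

lemma end_pairs_eq_UN_orbit_pair:
  assumes "m > 3"
  shows "end_pairs m = (\<Union>k<m - 2. orbit_pair m k ` {..<orbit_length m k})"
  using assms orbit_pair_in_end_pairs by (fastforce elim: end_pairs_obtain_orbit_pair)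

lemma orbit_pair_inject:
  assumes "m > 3" "k < m - 2" "r < orbit_length m k" "k' < m - 2" "r' < orbit_length m k'"
    "orbit_pair m k r = orbit_pair m k' r'"
  shows "k = k' \<and> r = r'"
proof -
  have "r = r'"
    using assms(6) by (auto simp: orbit_pair_def split: if_splits)
  moreover have "k = k'"
    using assms unfolding \<open>r = r'\<close>
    by (auto simp: orbit_pair_def orbit_length_def split: if_splits)
  ultimately show ?thesis by simp
qed

lemma pair_promotion_orbit_pair:
  assumes "m > 3" "k < m - 2" "r < orbit_length m k"
  shows "pair_promotion m (orbit_pair m k (Suc r mod orbit_length m k)) = orbit_pair m k r"
proof (cases "Suc r = orbit_length m k")
  case True
  then have "pair_promotion m (orbit_pair m k 0) = orbit_pair m k r"
    using assms by (auto simp: pair_promotion_def orbit_pair_def orbit_length_def split: if_splits)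
  with True show ?thesis by simp
next
  case False
  with assms(3) have "Suc r < orbit_length m k" by simp
  moreover from this have "pair_promotion m (orbit_pair m k (Suc r)) = orbit_pair m k r"
    using assms by (auto simp: pair_promotion_def orbit_pair_def orbit_length_def split: if_splits)
  ultimately show ?thesis by simp
qed

definition ribbon_orbit :: "nat \<Rightarrow> nat \<Rightarrow> tableau set" where
  "ribbon_orbit m k = (\<lambda>r. ribbon_tableau m (orbit_pair m k r)) ` {..<orbit_length m k}"

context
  fixes m :: nat
  assumes m_gt_3: "m > 3"
begin

lemma orbit_length_pos: "0 < orbit_length m k"
  using m_gt_3 by (simp add: orbit_length_def)

lemma SYT_R_eq_UN_ribbon_orbit: "SYT_R m = (\<Union>k<m - 2. ribbon_orbit m k)"
  by (simp add: SYT_R_eq_image[OF m_gt_3] end_pairs_eq_UN_orbit_pair[OF m_gt_3]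
      ribbon_orbit_def image_UN image_image)

lemma ribbon_promotion_orbit_pair:
  assumes "k < m - 2" "r < orbit_length m k"
  shows "ribbon_promotion m (ribbon_tableau m (orbit_pair m k (Suc r mod orbit_length m k))) =
    ribbon_tableau m (orbit_pair m k r)"
proof -
  have "orbit_pair m k (Suc r mod orbit_length m k) \<in> end_pairs m"
    using assms(1) by (simp add: orbit_pair_in_end_pairs[OF m_gt_3] orbit_length_pos)
  then show ?thesis
    using assms
    by (simp add: ribbon_promotion_def SYT_R_eq_image[OF m_gt_3] promotion_ribbon_tableau[OF m_gt_3]
        pair_promotion_orbit_pair[OF m_gt_3])
qed

lemma SYT_R_subset_ribbon_promotion_image: "SYT_R m \<subseteq> ribbon_promotion m ` SYT_R m"
proof
  fix T assume "T \<in> SYT_R m"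
  then obtain k r where k_less: "k < m - 2" and "r < orbit_length m k"
    and "T = ribbon_tableau m (orbit_pair m k r)"
    by (auto simp: SYT_R_eq_UN_ribbon_orbit ribbon_orbit_def)
  then have "T = ribbon_promotion m
      (ribbon_tableau m (orbit_pair m k (Suc r mod orbit_length m k)))"
    by (simp add: ribbon_promotion_orbit_pair)
  moreover have "ribbon_tableau m (orbit_pair m k (Suc r mod orbit_length m k)) \<in> SYT_R m"
    using k_less orbit_length_pos[of k]
    by (auto simp: SYT_R_eq_image[OF m_gt_3] intro!: orbit_pair_in_end_pairs[OF m_gt_3])
  ultimately show "T \<in> ribbon_promotion m ` SYT_R m"
    by blast
qed

lemma finite_permutation_ribbon_promotion: "finite_permutation (SYT_R m) (ribbon_promotion m)"
proof
  show "finite (SYT_R m)"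
    by (simp add: SYT_R_eq_UN_ribbon_orbit ribbon_orbit_def)
  then show "ribbon_promotion m \<in> carrier (BijGroup (SYT_R m))"
  proof (rule surj_imp_in_carrier_BijGroup)
    show "ribbon_promotion m \<in> extensional (SYT_R m)"
      by (simp add: ribbon_promotion_def)
  qed (rule SYT_R_subset_ribbon_promotion_image)
qed

lemma orbits_ribbon_promotion:
  "orbits (subgroup_generated (BijGroup (SYT_R m)) {ribbon_promotion m}) (SYT_R m) (\<lambda>g. g) =
    ribbon_orbit m ` {..<m - 2}"
proof -
  interpret finite_permutation "SYT_R m" "ribbon_promotion m"
    by (rule finite_permutation_ribbon_promotion)
  have "p_orbit (ribbon_tableau m (orbit_pair m k r)) = ribbon_orbit m k"
    if "k < m - 2" "r < orbit_length m k" for k r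
    unfolding ribbon_orbit_def
  proof (rule p_orbit_eq_image_cycle[OF orbit_length_pos _ _ that(2)])
    show "(\<lambda>r. ribbon_tableau m (orbit_pair m k r)) ` {..<orbit_length m k} \<subseteq> SYT_R m"
      using that(1) SYT_R_eq_UN_ribbon_orbit by (auto simp: ribbon_orbit_def)
  qed (rule ribbon_promotion_orbit_pair[OF that(1)])
  then have orbit: "p_orbit T = ribbon_orbit m k" if "k < m - 2" "T \<in> ribbon_orbit m k" for T k
    using that by (auto simp: ribbon_orbit_def)
  moreover have "ribbon_orbit m k \<noteq> {}" for k
    using orbit_length_pos[of k] by (auto simp: ribbon_orbit_def)
  ultimately show ?thesis
    unfolding orbits_def SYT_R_eq_UN_ribbon_orbit by (fastforce simp: image_iff)
qed

lemma card_ribbon_orbit: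
  assumes "k < m - 2"
  shows "card (ribbon_orbit m k) = orbit_length m k"
proof -
  have "inj_on (\<lambda>r. ribbon_tableau m (orbit_pair m k r)) {..<orbit_length m k}"
    by (rule inj_onI)
      (use assms orbit_pair_inject[OF m_gt_3] in \<open>auto simp: inj_eq[OF inj_ribbon_tableau]\<close>)
  then show ?thesis
    by (simp add: ribbon_orbit_def card_image)
qed

lemma inj_on_ribbon_orbit: "inj_on (ribbon_orbit m) {..<m - 2}"
proof (rule inj_onI)
  fix k k' assume indices: "k \<in> {..<m - 2}" "k' \<in> {..<m - 2}"
    and "ribbon_orbit m k = ribbon_orbit m k'"
  then have "ribbon_tableau m (orbit_pair m k 0) \<in> ribbon_orbit m k'"
    using orbit_length_pos[of k] by (auto simp: ribbon_orbit_def)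
  then obtain r where "r < orbit_length m k'" "orbit_pair m k 0 = orbit_pair m k' r"
    by (auto simp: ribbon_orbit_def inj_eq[OF inj_ribbon_tableau])
  then show "k = k'"
    using indices orbit_pair_inject[OF m_gt_3, of k 0 k' r] orbit_length_pos[of k] by simp
qed

lemma card_ribbon_orbits_of_size:
  "card {Q \<in> ribbon_orbit m ` {..<m - 2}. card Q = l} = card {k. k < m - 2 \<and> orbit_length m k = l}"
proof -
  have "{Q \<in> ribbon_orbit m ` {..<m - 2}. card Q = l} =
      ribbon_orbit m ` {k. k < m - 2 \<and> orbit_length m k = l}"
    by (auto simp: card_ribbon_orbit)
  moreover have "inj_on (ribbon_orbit m) {k. k < m - 2 \<and> orbit_length m k = l}"
    by (rule inj_on_subset[OF inj_on_ribbon_orbit]) auto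
  ultimately show ?thesis
    by (simp add: card_image)
qed

lemma card_short_ribbon_orbits: "card {Q \<in> ribbon_orbit m ` {..<m - 2}. card Q = m - 2} = 1"
proof -
  have "{k. k < m - 2 \<and> orbit_length m k = m - 2} = {0}"
    using m_gt_3 by (auto simp: orbit_length_def)
  then show ?thesis
    by (simp add: card_ribbon_orbits_of_size)
qed

lemma card_long_ribbon_orbits: "card {Q \<in> ribbon_orbit m ` {..<m - 2}. card Q = m - 1} = m - 3"
proof -
  have "{k. k < m - 2 \<and> orbit_length m k = m - 1} = {1..<m - 2}"
    using m_gt_3 by (auto simp: orbit_length_def)
  then show ?thesis
    by (simp add: card_ribbon_orbits_of_size)
qed

lemma two_coprime_orbit_sizes_ribbon_promotion:
  "two_coprime_orbit_sizes (SYT_R m) (ribbon_promotion m) (m - 2) (m - 1)"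
proof (intro two_coprime_orbit_sizes.intro two_coprime_orbit_sizes_axioms.intro
    finite_permutation_ribbon_promotion)
  have "card ` ribbon_orbit m ` {..<m - 2} = orbit_length m ` {..<m - 2}"
    by (simp add: image_image card_ribbon_orbit)
  also have "\<dots> = {m - 2, m - 1}"
  proof -
    have "{..<m - 2} = insert 0 (insert 1 {2..<m - 2})"
      using m_gt_3 by auto
    then show ?thesis
      by (auto simp: orbit_length_def)
  qed
  finally show "card ` orbits (subgroup_generated (BijGroup (SYT_R m)) {ribbon_promotion m})
      (SYT_R m) (\<lambda>g. g) = {m - 2, m - 1}"
    by (simp only: orbits_ribbon_promotion)
  have "m - 1 = Suc (m - 2)"
    using m_gt_3 by simp
  then show "coprime (m - 2) (m - 1)" "m - 2 \<noteq> m - 1"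
    by (simp_all only: coprime_Suc_right_nat n_not_Suc_n not_False_eq_True)
qed

end

theorem mainTheorem17:
  fixes m :: nat and \<xi> \<zeta> :: complex
  assumes "m > 3"
    and "primitive_root_of_unity (m - 1) \<xi>"
    and "primitive_root_of_unity (m - 2) \<zeta>"
  shows
    "let X = SYT_R m; B = BijGroup X; p = ribbon_promotion m;
         Orb = orbits (subgroup_generated B {p}) X (\<lambda>g. g)
     in p \<in> carrier B \<and>
        group.ord B p = (m - 1) * (m - 2) \<and>
        card {Q \<in> Orb. card Q = m - 2} = 1 \<and>
        card {Q \<in> Orb. card Q = m - 1} = m - 3 \<and>
        (\<forall>Q \<in> Orb. card Q = m - 2 \<or> card Q = m - 1) \<and>
        (\<forall>r s :: int.
           eval2 (psi m) (\<xi> powi r) (\<zeta> powi s) =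
           of_nat (card {T \<in> X. (p [^]\<^bsub>B\<^esub> (r * (int m - 2) + s * (int m - 1))) T = T})) \<and>
        bicyclic_sieving
          (subgroup_generated B {p [^]\<^bsub>B\<^esub> (m - 2)}) (p [^]\<^bsub>B\<^esub> (m - 2))
          (subgroup_generated B {p [^]\<^bsub>B\<^esub> (m - 1)}) (p [^]\<^bsub>B\<^esub> (m - 1))
          X (\<lambda>(g, h). g \<otimes>\<^bsub>B\<^esub> h) (psi m)"
proof -
  note m_gt_3 = assms(1)
  interpret two_coprime_orbit_sizes "SYT_R m" "ribbon_promotion m" "m - 2" "m - 1"
    by (rule two_coprime_orbit_sizes_ribbon_promotion[OF m_gt_3])
  have counts: "card {Q \<in> p_orbits. card Q = m - 2} = 1"
    "card {Q \<in> p_orbits. card Q = m - 1} = m - 3"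
    by (simp_all only: orbits_ribbon_promotion[OF m_gt_3] card_short_ribbon_orbits[OF m_gt_3]
        card_long_ribbon_orbits[OF m_gt_3])
  have sizes: "\<forall>Q\<in>p_orbits. card Q = m - 2 \<or> card Q = m - 1"
    using card_p_orbits by blast
  have psi: "orbit_size_poly = psi m"
    unfolding orbit_size_poly_def psi_def counts by simp
  have "int (m - 2) = int m - 2" "int (m - 1) = int m - 1"
    using m_gt_3 by simp_all
  then have fixed: "eval2 (psi m) (\<xi> powi r) (\<zeta> powi s) =
      of_nat (card {T \<in> SYT_R m.
        (ribbon_promotion m [^]\<^bsub>B\<^esub> (r * (int m - 2) + s * (int m - 1))) T = T})" for r s :: int
    using eval2_orbit_size_poly[OF assms(2,3), of r s] by (simp only: psi)
  show ?thesis
    unfolding Let_def mult.commute[of "m - 1"]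
    using p_closed ord_eq_mult counts sizes fixed
      bicyclic_sieving_orbit_size_poly[unfolded psi] by blast
qed

end
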